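(* Let $R\ge 1$ and $K\ge 1$ be integers, let $n\in\mathbb{Z}$ and put $\theta=\frac{n\pi}{2}$. Let $a,b\colon\mathbb{Z}^2\to\mathbb{R}^K$ be functions ($a$ the feature map, $b$ the filter) such that all the sums defining $\phi_r(a,b)(x,y)$, for $r\in\{0,1,\ldots,4R-1\}$ and $(x,y)\in\mathbb{Z}^2$, converge absolutely. Let $\Theta$ be the rotation operation and $\phi$ the conic convolution operation with $4R$ conic regions, both as defined in the context. Then for all $(x,y)\in\mathbb{Z}^2$, $$\phi(\Theta(a,\theta),b)(x,y)=\Theta(\phi(a,b),\theta)(x,y).$$
   Context: **Rotation operation.** For $\alpha\in\mathbb{R}$ let $\rho_\alpha\colon\mathbb{R}^2\to\mathbb{R}^2$ be the counter-clockwise rotation by $\alpha$ about the origin, $\rho_\alpha(x,y)=(x\cos\alpha-y\sin\alpha,\;x\sin\alpha+y\cos\alpha)$. For each $m\ge 1$ fix an interpolation scheme (for example nearest value or bilinear), i.e. a map $E$ sending each function $f\colon\mathbb{Z}^2\to\mathbb{R}^m$ to a function $Ef\colon\mathbb{R}^2\to\mathbb{R}^m$ with $(Ef)|_{\mathbb{Z}^2}=f$. The operation $\Theta$ rotates a function counter-clockwise by the angle $\alpha$: $$\Theta(f,\alpha)(p)=(Ef)(\rho_{-\alpha}(p)),\qquad p\in\mathbb{Z}^2.$$ In particular, for $\alpha=\frac{n\pi}{2}$ with $n\in\mathbb{Z}$ no interpolation is needed: $\Theta(f,\frac{n\pi}{2})(x,y)=f(\mu_n(x,y))$, where $\mu_n(x,y)$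 equals $(x,y)$, $(y,-x)$, $(-x,-y)$, $(-y,x)$ when $n\bmod 4=0,1,2,3$ respectively. **Conic regions and boundaries.** Let $\theta_r=\frac{2\pi r}{4R}$. For $(x,y)\in\mathbb{Z}^2\setminus\{(0,0)\}$ let $\arg(x,y)\in[0,2\pi)$ be its polar angle (equal to $\operatorname{arccot}(x/y)+\pi\,\mathbb{I}(y<0)$, with $\operatorname{arccot}$ valued in $[0,\pi]$ and the limiting values $0$ if $y=0,x>0$ and $\pi$ if $y=0,x<0$). For $r\in\{0,1,\ldots,4R-1\}$ define $$\mathcal{C}_r=\{(x,y)\in\mathbb{Z}^2\setminus\{(0,0)\}\colon\theta_r<\arg(x,y)<\theta_{r+1}\},\qquad \mathcal{B}_r=\{(x,y)\in\mathbb{Z}^2\setminus\{(0,0)\}\colon\arg(x,y)=\theta_r\}.$$ These sets together with $\{(0,0)\}$ partition $\mathbb{Z}^2$. **Convolution with a rotated filter.** For $a,b\colon\mathbb{Z}^2\to\mathbb{R}^K$ and $r\in\{0,\ldots,4R-1\}$, $$\phi_r(a,b)(x,y)=\sum_{(x',y')\in\mathbb{Z}^2}\Theta(b,\theta_r)(x',y')\cdot a(x-x',y-y'),$$ where $\cdot$ is the standard inner product on $\mathbb{R}^K$, so $\phi_r(a,b)$ is real-valued. Indices $r$ are read modulo $4R$, so $\phi_{4R}=\phi_0$. **Conic convolution.** $\phi(a,b)\colon\mathbb{Z}^2\to\mathbb{R}$ is defined by $$\phi(a,b)(x,y)=\begin{cases}\phi_r(a,b)(x,y) & \text{if }(x,y)\in\mathcal{C}_r,\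 r\in\{0,\ldots,4R-1\},\\ \max\{\phi_r(a,b)(x,y),\ \phi_{r+1}(a,b)(x,y)\} & \text{if }(x,y)\in\mathcal{B}_r,\ r\in\{0,\ldots,4R-1\},\\ \max_{r\in\{0,1,\ldots,4R-1\}}\phi_r(a,b)(x,y) & \text{if }(x,y)=(0,0).\end{cases}$$ *)

theory Defs
  imports "HOL-Analysis.Analysis"
begin

definition emb :: "int \<times> int \<Rightarrow> real \<times> real" where
  "emb p = (real_of_int (fst p), real_of_int (snd p))"

definition rho :: "real \<Rightarrow> real \<times> real \<Rightarrow> real \<times> real" where
  "rho \<alpha> q = (fst q * cos \<alpha> - snd q * sin \<alpha>, fst q * sin \<alpha> + snd q * cos \<alpha>)"

(* No property of an interpolation scheme is required beyond agreement with f on the lattice;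
   in particular it need not be linear or compatible with rotations. *)
definition interpolation :: "((int \<times> int \<Rightarrow> 'v) \<Rightarrow> real \<times> real \<Rightarrow> 'v) \<Rightarrow> bool" where
  "interpolation E \<longleftrightarrow> (\<forall>f p. E f (emb p) = f p)"

definition Theta ::
  "((int \<times> int \<Rightarrow> 'v) \<Rightarrow> real \<times> real \<Rightarrow> 'v) \<Rightarrow> (int \<times> int \<Rightarrow> 'v) \<Rightarrow> real \<Rightarrow> int \<times> int \<Rightarrow> 'v" where
  "Theta E f \<alpha> p = E f (rho (- \<alpha>) (emb p))"

definition theta :: "nat \<Rightarrow> nat \<Rightarrow> real" where
  "theta R r = 2 * pi * real r / (4 * real R)"

definition polar_angle :: "int \<times> int \<Rightarrow> real" where
  "polar_angle p = Arg2pi (Complex (real_of_int (fst p)) (real_of_int (snd p)))"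

definition conic_region :: "nat \<Rightarrow> nat \<Rightarrow> (int \<times> int) set" where
  "conic_region R r =
     {p. p \<noteq> (0, 0) \<and> theta R r < polar_angle p \<and> polar_angle p < theta R (r + 1)}"

definition conic_boundary :: "nat \<Rightarrow> nat \<Rightarrow> (int \<times> int) set" where
  "conic_boundary R r = {p. p \<noteq> (0, 0) \<and> polar_angle p = theta R r}"

definition phi_term ::
  "((int \<times> int \<Rightarrow> real ^ 'k) \<Rightarrow> real \<times> real \<Rightarrow> real ^ 'k) \<Rightarrow> nat \<Rightarrow> nat \<Rightarrow>
   (int \<times> int \<Rightarrow> real ^ 'k) \<Rightarrow> (int \<times> int \<Rightarrow> real ^ 'k) \<Rightarrow> int \<times> int \<Rightarrow> int \<times> int \<Rightarrow> real" where
  "phi_term E R r a b p q = Theta E b (theta R r) q \<bullet> a (fst p - fst q, snd p - snd q)"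

definition phi_rot ::
  "((int \<times> int \<Rightarrow> real ^ 'k) \<Rightarrow> real \<times> real \<Rightarrow> real ^ 'k) \<Rightarrow> nat \<Rightarrow> nat \<Rightarrow>
   (int \<times> int \<Rightarrow> real ^ 'k) \<Rightarrow> (int \<times> int \<Rightarrow> real ^ 'k) \<Rightarrow> int \<times> int \<Rightarrow> real" where
  "phi_rot E R r a b p = (\<Sum>\<^sub>\<infinity>q\<in>UNIV. phi_term E R r a b p q)"

(* For R > 0 the conic regions, the boundaries and the origin partition the lattice, so the
   definite descriptions below denote the unique index of the cell containing p. *)
definition conic_conv ::
  "((int \<times> int \<Rightarrow> real ^ 'k) \<Rightarrow> real \<times> real \<Rightarrow> real ^ 'k) \<Rightarrow> nat \<Rightarrow>
   (int \<times> int \<Rightarrow> real ^ 'k) \<Rightarrow> (int \<times> int \<Rightarrow> real ^ 'k) \<Rightarrow> int \<times> int \<Rightarrow> real" where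
  "conic_conv E R a b p =
     (if p = (0, 0) then Max ((\<lambda>r. phi_rot E R r a b p) ` {0..<4 * R})
      else if \<exists>r<4 * R. p \<in> conic_region R r then
        phi_rot E R (THE r. r < 4 * R \<and> p \<in> conic_region R r) a b p
      else
        (let r = (THE r. r < 4 * R \<and> p \<in> conic_boundary R r)
         in max (phi_rot E R r a b p) (phi_rot E R ((r + 1) mod (4 * R)) a b p)))"

end

theory Submission
  imports Defs
begin

text \<open>
  A rotation by \<open>n \<pi> / 2\<close> is an iterate of the lattice quarter turn, so it suffices to treat one
  quarter turn. It permutes the cells of the partition and shifts their index by \<open>R\<close>
  modulo \<open>4 R\<close>. Since \<open>\<theta>\<^sub>r + \<pi> / 2 = \<theta>\<^sub>r\<^sub>+\<^sub>R\<close>, rotating the filter further by a quarter turn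
  shifts its index in the same way, whatever the interpolation scheme is: the sample points
  themselves agree. Reindexing the convolution sum along the quarter turn then matches the two sides.
\<close>

section \<open>Clockwise lattice quarter turn and the rotation operation\<close>

definition quarter_turn :: "int \<times> int \<Rightarrow> int \<times> int" where
  "quarter_turn p = (snd p, - fst p)"

lemma quarter_turn_eq_origin_iff: "quarter_turn p = (0, 0) \<longleftrightarrow> p = (0, 0)"
  by (cases p) (auto simp: quarter_turn_def)

lemma bij_quarter_turn: "bij quarter_turn"
  by (rule o_bij[where g = "\<lambda>p. (- snd p, fst p)"]) (auto simp: quarter_turn_def)

lemma rho_add: "rho (\<alpha> + \<beta>) q = rho \<alpha> (rho \<beta> q)"
  by (simp add: rho_def cos_add sin_add algebra_simps)

lemma rho_add_2pi_int: "rho (\<alpha> + of_int m * (2 * pi)) q = rho \<alpha> q"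
proof -
  have "cos (of_int m * (2 * pi)) = 1" "sin (of_int m * (2 * pi)) = 0"
    using cos_int_2pin[of m] sin_int_2pin[of m] by (simp_all add: mult.commute)
  then have "rho (of_int m * (2 * pi)) q = q"
    by (simp only: rho_def) simp
  then show ?thesis
    by (simp only: rho_add)
qed

lemma rho_neg_half_pi_emb: "rho (- (pi / 2)) (emb p) = emb (quarter_turn p)"
  by (simp add: rho_def emb_def quarter_turn_def)

lemma rho_emb_nat_quarter_turns:
  "rho (- (real k * pi / 2)) (emb p) = emb ((quarter_turn ^^ k) p)"
proof (induction k)
  case 0
  show ?case by (simp add: rho_def)
next
  case (Suc k)
  have "- (real (Suc k) * pi / 2) = - (pi / 2) + - (real k * pi / 2)"
    by (simp add: field_simps)
  then show ?case
    by (simp only: rho_add Suc.IH rho_neg_half_pi_emb) simp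
qed

text \<open>The sample points are lattice points, where every interpolation scheme returns
  \<open>f\<close> itself. Reducing \<open>n\<close> modulo 4 drops full turns and makes the number
  of iterates nonnegative, also for negative \<open>n\<close>.\<close>

lemma Theta_quarter_turns:
  assumes "interpolation E"
  shows "Theta E f (of_int n * pi / 2) = f \<circ> (quarter_turn ^^ nat (n mod 4))"
proof
  fix p
  define k where "k = nat (n mod 4)"
  have "n = 4 * (n div 4) + int k"
    by (simp add: k_def)
  then have "real_of_int n = 4 * real_of_int (n div 4) + real k"
    by (metis of_int_add of_int_mult of_int_numeral of_int_of_nat_eq)
  then have "- (real_of_int n * pi / 2)
      = - (real k * pi / 2) + of_int (- (n div 4)) * (2 * pi)"
    by (simp add: field_simps)
  then have "rho (- (of_int n * pi / 2)) (emb p) = emb ((quarter_turn ^^ k) p)"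
    by (simp only: rho_add_2pi_int rho_emb_nat_quarter_turns)
  then show "Theta E f (of_int n * pi / 2) p = (f \<circ> (quarter_turn ^^ nat (n mod 4))) p"
    using assms unfolding interpolation_def by (simp only: Theta_def k_def o_apply)
qed

section \<open>Shift of the sector index and of the rotated filter\<close>

definition turned_index :: "nat \<Rightarrow> nat \<Rightarrow> nat" where
  "turned_index R r = (r + 3 * R) mod (4 * R)"

lemma turned_index_less: "R \<ge> 1 \<Longrightarrow> turned_index R r < 4 * R"
  by (simp add: turned_index_def)

lemma turned_index_cases:
  assumes "r < 4 * R"
  shows "turned_index R r = (if r < R then r + 3 * R else r - R)"
  using assms by (auto simp: turned_index_def mod_if)

lemma turned_index_image:
  assumes "R \<ge> 1"
  shows "turned_index R ` {0..<4 * R} = {0..<4 * R}"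
proof (rule endo_inj_surj)
  show "turned_index R ` {0..<4 * R} \<subseteq> {0..<4 * R}"
    using turned_index_less[OF assms] by auto
  show "inj_on (turned_index R) {0..<4 * R}"
    by (auto simp: inj_on_def turned_index_cases split: if_splits)
qed simp

text \<open>On a boundary the maximum involves an index and its cyclic successor; this keeps such a
  pair together under the shift.\<close>

lemma turned_index_succ:
  "turned_index R ((r + 1) mod (4 * R)) = (turned_index R r + 1) mod (4 * R)"
  by (simp add: turned_index_def mod_simps ac_simps)

lemma theta_turned_index:
  assumes "r < 4 * R"
  shows "theta R (turned_index R r) = theta R r + (if r < R then 3 * pi / 2 else - (pi / 2))"
  using assms by (auto simp: turned_index_cases theta_def of_nat_diff field_simps)

lemma rho_theta_quarter_turn:
  assumes "r < 4 * R"
  shows "rho (- theta R (turned_index R r)) (emb (quarter_turn p)) = rho (- theta R r) (emb p)"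
proof -
  \<comment> \<open>If \<open>r < R\<close>, the index wraps around and the two angles differ by a
    full turn; otherwise they are equal.\<close>
  have "- theta R (turned_index R r) + - (pi / 2)
      = - theta R r + of_int (if r < R then - 1 else 0) * (2 * pi)"
    using theta_turned_index[OF assms] by simp
  then show ?thesis
    by (metis rho_neg_half_pi_emb rho_add rho_add_2pi_int)
qed

text \<open>Substitute \<open>quarter_turn q\<close> for the summation variable: the filter is
  sampled at the same real points, and by additivity \<open>quarter_turn p - quarter_turn q\<close>
  is the quarter turn of \<open>p - q\<close>.\<close>

lemma phi_rot_quarter_turn:
  assumes "r < 4 * R"
  shows "phi_rot E R r (a \<circ> quarter_turn) b p = phi_rot E R (turned_index R r) a b (quarter_turn p)"
proof -
  have "phi_term E R (turned_index R r) a b (quarter_turn p) (quarter_turn q)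
      = phi_term E R r (a \<circ> quarter_turn) b p q" for q
    using rho_theta_quarter_turn[OF assms, of q]
    by (simp add: phi_term_def Theta_def) (simp add: quarter_turn_def)
  then show ?thesis
    unfolding phi_rot_def
    by (subst infsum_reindex_bij_betw[OF bij_quarter_turn, symmetric]) simp
qed

section \<open>Polar angles and sector coordinates\<close>

lemma polar_angle_quarter_turn:
  assumes "p \<noteq> (0, 0)"
  shows "polar_angle (quarter_turn p)
    = polar_angle p + (if polar_angle p < pi / 2 then 3 * pi / 2 else - (pi / 2))"
proof -
  define z where "z = Complex (real_of_int (fst p)) (real_of_int (snd p))"
  define A where "A = Arg2pi z"
  define B where "B = A + (if A < pi / 2 then 3 * pi / 2 else - (pi / 2))"
  have A: "0 \<le> A" "A < 2 * pi" "z = of_real (norm z) * exp (\<i> * of_real A)"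
    unfolding A_def using Arg2pi[of z] by (auto simp: is_Arg_def)
  have "z \<noteq> 0"
    using assms by (cases p) (auto simp: z_def complex_eq_iff)
  \<comment> \<open>Periodicity reduces the wrapped case to the angle
    \<open>A - pi / 2\<close>.\<close>
  have "A + 3 * pi / 2 = A - pi / 2 + 2 * pi"
    by simp
  then have "cos (A + 3 * pi / 2) = sin A" "sin (A + 3 * pi / 2) = - cos A"
    by (simp_all only: cos_periodic sin_periodic) (simp_all add: cos_diff sin_diff)
  then have "cis B = - \<i> * cis A"
    by (auto simp: B_def complex_eq_iff cos_diff sin_diff)
  then have "of_real (norm z) * exp (\<i> * of_real B) = - \<i> * z"
    by (subst A(3)) (simp add: cis_conv_exp)
  \<comment> \<open>The case split in \<open>B\<close> keeps it in [0, 2 pi), where the argument is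
    unique.\<close>
  then have "Arg2pi (- \<i> * z) = B"
    using A(1,2) \<open>z \<noteq> 0\<close> by (intro Arg2pi_unique[of "norm z"]) (auto simp: B_def)
  moreover have "- \<i> * z
      = Complex (real_of_int (fst (quarter_turn p))) (real_of_int (snd (quarter_turn p)))"
    by (simp add: z_def quarter_turn_def complex_eq_iff)
  ultimately show ?thesis
    by (simp add: polar_angle_def B_def A_def z_def)
qed

text \<open>With the sector width as unit of angle, regions become open unit intervals, boundaries
  become integers, and a quarter turn becomes a shift by \<open>R\<close> modulo
  \<open>4 * R\<close>.\<close>

definition sector_coordinate :: "nat \<Rightarrow> int \<times> int \<Rightarrow> real" where
  "sector_coordinate R p = polar_angle p * (4 * real R) / (2 * pi)"

lemma sector_coordinate_bounds:
  assumes "R \<ge> 1"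
  shows "0 \<le> sector_coordinate R p" "sector_coordinate R p < 4 * real R"
proof -
  have "0 \<le> polar_angle p" "polar_angle p < 2 * pi"
    using Arg2pi by (auto simp: polar_angle_def)
  then show "0 \<le> sector_coordinate R p" "sector_coordinate R p < 4 * real R"
    using assms by (auto simp: sector_coordinate_def field_simps)
qed

lemma conic_region_iff:
  assumes "R \<ge> 1"
  shows "p \<in> conic_region R r
    \<longleftrightarrow> p \<noteq> (0, 0) \<and> real r < sector_coordinate R p \<and> sector_coordinate R p < real r + 1"
  using assms by (auto simp: conic_region_def sector_coordinate_def theta_def field_simps)

lemma conic_boundary_iff:
  assumes "R \<ge> 1"
  shows "p \<in> conic_boundary R r \<longleftrightarrow> p \<noteq> (0, 0) \<and> sector_coordinate R p = real r"
  using assms by (auto simp: conic_boundary_def sector_coordinate_def theta_def field_simps)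

lemma sector_coordinate_quarter_turn:
  assumes "R \<ge> 1" "p \<noteq> (0, 0)"
  shows "sector_coordinate R (quarter_turn p)
    = sector_coordinate R p + (if sector_coordinate R p < real R then 3 * real R else - real R)"
proof -
  have "sector_coordinate R p < real R \<longleftrightarrow> polar_angle p < pi / 2"
    using assms by (simp add: sector_coordinate_def field_simps)
  then show ?thesis
    using polar_angle_quarter_turn[OF assms(2)]
    by (auto simp: sector_coordinate_def field_simps)
qed

lemma lattice_cell_cases:
  assumes "R \<ge> 1"
  obtains (origin) "p = (0, 0)"
  | (region) r where "r < 4 * R" "p \<in> conic_region R r"
  | (boundary) r where "r < 4 * R" "p \<in> conic_boundary R r"
proof (cases "p = (0, 0)")
  case False
  define t where "t = sector_coordinate R p"
  \<comment> \<open>The floor is the cell index: equality with \<open>t\<close> means a boundary,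
    strict inequality a region.\<close>
  define r where "r = nat \<lfloor>t\<rfloor>"
  have t: "0 \<le> t" "t < 4 * real R"
    using sector_coordinate_bounds[OF assms] by (auto simp: t_def)
  then have r: "real r \<le> t" "t < real r + 1"
    by (auto simp: r_def)
  then have "r < 4 * R"
    using t by linarith
  then show ?thesis
    using r False region boundary conic_region_iff[OF assms] conic_boundary_iff[OF assms]
    unfolding t_def by (metis order_le_less)
qed (rule origin)

section \<open>Values of the conic convolution on each kind of cell\<close>

lemma conic_conv_origin:
  "conic_conv E R a b (0, 0) = Max ((\<lambda>r. phi_rot E R r a b (0, 0)) ` {0..<4 * R})"
  by (simp add: conic_conv_def)

lemma conic_conv_region:
  assumes "R \<ge> 1" "r < 4 * R" "p \<in> conic_region R r"
  shows "conic_conv E R a b p = phi_rot E R r a b p"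
proof -
  have "(THE s. s < 4 * R \<and> p \<in> conic_region R s) = r"
    using assms by (intro the_equality) (auto simp: conic_region_iff)
  moreover have "p \<noteq> (0, 0)"
    using assms by (simp add: conic_region_iff)
  ultimately show ?thesis
    using assms(2,3) by (auto simp: conic_conv_def)
qed

text \<open>An integer sector coordinate lies in no open unit interval between consecutive integers,
  so the region branch, tested first, is not taken; it also determines \<open>r\<close>
  uniquely.\<close>

lemma conic_conv_boundary:
  assumes "R \<ge> 1" "r < 4 * R" "p \<in> conic_boundary R r"
  shows "conic_conv E R a b p
    = max (phi_rot E R r a b p) (phi_rot E R ((r + 1) mod (4 * R)) a b p)"
proof -
  have "(THE s. s < 4 * R \<and> p \<in> conic_boundary R s) = r"
    using assms by (intro the_equality) (auto simp: conic_boundary_iff)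
  moreover have "p \<noteq> (0, 0)" "\<not> (\<exists>s<4 * R. p \<in> conic_region R s)"
    using assms by (auto simp: conic_boundary_iff conic_region_iff)
  ultimately show ?thesis
    unfolding conic_conv_def by (simp only: Let_def if_False)
qed

section \<open>Equivariance under quarter turns\<close>

lemma quarter_turn_conic_region:
  assumes "R \<ge> 1" "r < 4 * R" "p \<in> conic_region R r"
  shows "quarter_turn p \<in> conic_region R (turned_index R r)"
proof -
  have p: "p \<noteq> (0, 0)" "real r < sector_coordinate R p" "sector_coordinate R p < real r + 1"
    using assms by (auto simp: conic_region_iff)
  \<comment> \<open>As \<open>R\<close> is an integer, it cannot separate the coordinate from its
    floor \<open>r\<close>, so both shifts wrap in the same case.\<close>
  have "sector_coordinate R p < real R \<longleftrightarrow> r < R"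
    using p by linarith
  then show ?thesis
    using p assms(1)
    by (auto simp: conic_region_iff quarter_turn_eq_origin_iff turned_index_cases[OF assms(2)]
        sector_coordinate_quarter_turn of_nat_diff)
qed

lemma quarter_turn_conic_boundary:
  assumes "R \<ge> 1" "r < 4 * R" "p \<in> conic_boundary R r"
  shows "quarter_turn p \<in> conic_boundary R (turned_index R r)"
  using assms
  by (auto simp: conic_boundary_iff quarter_turn_eq_origin_iff turned_index_cases
      sector_coordinate_quarter_turn of_nat_diff)

lemma conic_conv_quarter_turn:
  assumes R: "R \<ge> 1"
  shows "conic_conv E R (a \<circ> quarter_turn) b = conic_conv E R a b \<circ> quarter_turn"
proof
  fix p
  show "conic_conv E R (a \<circ> quarter_turn) b p = (conic_conv E R a b \<circ> quarter_turn) p"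
  proof (cases rule: lattice_cell_cases[OF R, of p, case_names origin region boundary])
    case origin
    \<comment> \<open>The shift permutes the indices, so both maxima range over the same set of
      values.\<close>
    have "(\<lambda>r. phi_rot E R r (a \<circ> quarter_turn) b p) ` {0..<4 * R}
        = (\<lambda>r. phi_rot E R r a b (quarter_turn p)) ` turned_index R ` {0..<4 * R}"
      unfolding image_image by (intro image_cong) (auto simp: phi_rot_quarter_turn)
    moreover have "quarter_turn p = p"
      by (simp add: origin quarter_turn_def)
    ultimately show ?thesis
      by (simp add: origin conic_conv_origin turned_index_image[OF R])
  next
    case (region r)
    then show ?thesis
      by (simp add: conic_conv_region[OF R region] phi_rot_quarter_turn
          conic_conv_region[OF R turned_index_less[OF R] quarter_turn_conic_region[OF R region]])
  next
    case (boundary r)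
    \<comment> \<open>This bound lets \<open>phi_rot_quarter_turn\<close> apply to the successor
      index too.\<close>
    have "(r + 1) mod (4 * R) < 4 * R"
      using R by simp
    then show ?thesis
      using boundary(1)
      by (simp only: conic_conv_boundary[OF R boundary] phi_rot_quarter_turn turned_index_succ o_apply
          conic_conv_boundary[OF R turned_index_less[OF R] quarter_turn_conic_boundary[OF R boundary]])
  qed
qed

lemma conic_conv_quarter_turns:
  assumes "R \<ge> 1"
  shows "conic_conv E R (a \<circ> (quarter_turn ^^ k)) b = conic_conv E R a b \<circ> (quarter_turn ^^ k)"
proof (induction k)
  case (Suc k)
  \<comment> \<open>The one-turn result is applied to the feature map
    \<open>a \<circ> (quarter_turn ^^ k)\<close>.\<close>
  have "conic_conv E R (a \<circ> (quarter_turn ^^ Suc k)) b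
      = conic_conv E R ((a \<circ> (quarter_turn ^^ k)) \<circ> quarter_turn) b"
    by (simp only: funpow_Suc_right o_assoc)
  then show ?case
    by (simp only: conic_conv_quarter_turn[OF assms] Suc.IH funpow_Suc_right o_assoc)
qed simp

theorem mainTheorem1:
  fixes R :: nat and n :: int
    and E :: "(int \<times> int \<Rightarrow> real ^ 'k) \<Rightarrow> real \<times> real \<Rightarrow> real ^ 'k"
    and E1 :: "(int \<times> int \<Rightarrow> real) \<Rightarrow> real \<times> real \<Rightarrow> real"
    and a b :: "int \<times> int \<Rightarrow> real ^ 'k"
    and \<theta> :: real
  assumes "R \<ge> 1"
    and "interpolation E" and "interpolation E1"
    and "\<theta> = of_int n * pi / 2"
    and "\<And>r p. r < 4 * R \<Longrightarrow> (\<lambda>q. \<bar>phi_term E R r a b p q\<bar>) summable_on UNIV"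
  shows "\<forall>x y. conic_conv E R (Theta E a \<theta>) b (x, y) = Theta E1 (conic_conv E R a b) \<theta> (x, y)"
  by (simp add: assms(4) Theta_quarter_turns[OF assms(2)] Theta_quarter_turns[OF assms(3)]
      conic_conv_quarter_turns[OF assms(1)])

end
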